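(* Conchoids of Nicomedes are rational. That is: let $\mathbb K$ be an algebraically closed field of characteristic zero, let $\mathcal C\subset\mathbb K^2$ be a line which is neither of the two lines $y_1\pm\sqrt{-1}\,y_2=0$, let $A\in\mathbb K^2$ with $A\notin\mathcal C$, and let $d\in\mathbb K\setminus\{0\}$. Then the conchoid of $\mathcal C$ from the focus $A$ and distance $d$ is rational.
   Context: A conchoid of Nicomedes is the conchoid of a line from a focus not on the line. For $P=(P_1,P_2)$ write $\|P\|^2=P_1^2+P_2^2$ (no conjugation). The conchoid of $\mathcal C$ from the focus $A$ and distance $d$ is the Zariski closure in $\mathbb K^2$ of the set of points $\bar x\in\mathbb K^2$ for which there exist $\bar y\in\mathcal C$ and $\lambda\in\mathbb K$ with $\|\bar x-\bar y\|^2=d^2$ and $\bar x=A+\lambda(\bar y-A)$. A plane curve is rational if it is irreducible and there is a pair of rational functions in $\mathbb K(t)^2$, not both constant, whose values are Zariski dense in the curve. *)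

theory Defs
  imports
    "HOL-Analysis.Finite_Cartesian_Product"
    "HOL-Computational_Algebra.Polynomial"
    "HOL-Computational_Algebra.Fraction_Field"
begin

(* K[x1,x2] is 'a poly poly: the outer variable is x2, the coefficients are polynomials in x1. *)
definition poly_at :: "'a::comm_ring_1 poly poly \<Rightarrow> 'a ^ 2 \<Rightarrow> 'a" where
  "poly_at f P = poly (poly f [:P $ 2:]) (P $ 1)"

definition algebraic_set :: "('a::field ^ 2) set \<Rightarrow> bool" where
  "algebraic_set Z \<longleftrightarrow> (\<exists>F. Z = {P. \<forall>f\<in>F. poly_at f P = 0})"

abbreviation zariski_closure :: "('a::field ^ 2) set \<Rightarrow> ('a ^ 2) set" where
  "zariski_closure S \<equiv> algebraic_set hull S"

definition irreducible_algebraic_set :: "('a::field ^ 2) set \<Rightarrow> bool" where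
  "irreducible_algebraic_set Z \<longleftrightarrow> algebraic_set Z \<and> Z \<noteq> {} \<and>
     (\<forall>Z1 Z2. algebraic_set Z1 \<longrightarrow> algebraic_set Z2 \<longrightarrow> Z = Z1 \<union> Z2 \<longrightarrow> Z = Z1 \<or> Z = Z2)"

definition plane_curve :: "('a::field ^ 2) set \<Rightarrow> bool" where
  "plane_curve Z \<longleftrightarrow> (\<exists>f. (\<forall>c. f \<noteq> [:[:c:]:]) \<and> Z = {P. poly_at f P = 0})"

(* R is defined at t with value v; the value does not depend on the fraction representing R. *)
definition fract_value :: "'a::field poly fract \<Rightarrow> 'a \<Rightarrow> 'a \<Rightarrow> bool" where
  "fract_value R t v \<longleftrightarrow>
     (\<exists>p q. R = Fract p q \<and> poly q t \<noteq> 0 \<and> v = poly p t / poly q t)"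

definition constant_fract :: "'a::field poly fract \<Rightarrow> bool" where
  "constant_fract R \<longleftrightarrow> (\<exists>c. R = Fract [:c:] 1)"

definition rational_curve :: "('a::field ^ 2) set \<Rightarrow> bool" where
  "rational_curve Z \<longleftrightarrow> plane_curve Z \<and> irreducible_algebraic_set Z \<and>
     (\<exists>R S. \<not> (constant_fract R \<and> constant_fract S) \<and>
        zariski_closure {P. \<exists>t. fract_value R t (P $ 1) \<and> fract_value S t (P $ 2)} = Z)"

(* The quadratic form P1^2 + P2^2, without conjugation; it has nonzero isotropic vectors. *)
definition sqnorm :: "'a::comm_ring_1 ^ 2 \<Rightarrow> 'a" where
  "sqnorm P = (P $ 1)\<^sup>2 + (P $ 2)\<^sup>2"

definition conchoid :: "('a::field ^ 2) set \<Rightarrow> 'a ^ 2 \<Rightarrow> 'a \<Rightarrow> ('a ^ 2) set" where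
  "conchoid C A d =
     zariski_closure {x. \<exists>y\<in>C. \<exists>k. sqnorm (x - y) = d\<^sup>2 \<and> x = A + k *s (y - A)}"

definition affine_line :: "('a::field ^ 2) set \<Rightarrow> bool" where
  "affine_line L \<longleftrightarrow>
     (\<exists>a b c. (a \<noteq> 0 \<or> b \<noteq> 0) \<and> L = {y. a * y $ 1 + b * y $ 2 + c = 0})"

end

theory Submission
  imports Defs "HOL-Analysis.Cartesian_Space"
begin

text \<open>
  Let \<open>i\<^sup>2 = -1\<close> and let \<open>u\<close>, \<open>v\<close> be the isotropic coordinates \<open>(x\<^sub>1 - A\<^sub>1) \<plusminus> i (x\<^sub>2 - A\<^sub>2)\<close>
  centred at the focus. They turn the quadratic form into the product \<open>u v\<close>, and the line into
  \<open>\<alpha> u + \<beta> v = \<gamma>\<close> with \<open>\<gamma> \<noteq> 0\<close>, because the line misses the focus. A point \<open>(U, V)\<close> on the ray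
  through the point \<open>(W, W')\<close> of the line is \<open>k (W, W')\<close>, and it belongs to the conchoid when
  \<open>(k - 1)\<^sup>2 W W' = d\<^sup>2\<close>. This forces \<open>W' / W\<close> to be the square of \<open>t = d / ((k - 1) W)\<close>, and solving
  for everything in terms of \<open>t\<close> gives the parametrization
    \<open>U = \<gamma> / (\<alpha> + \<beta> t\<^sup>2) + d / t\<close>,  \<open>V = t\<^sup>2 U\<close>
  (\<open>conchoid_relation_iff_parameter\<close>).

  Eliminating \<open>t\<close> by \<open>t\<^sup>2 = V / U\<close> gives the equation
  \<open>(l - \<gamma>)\<^sup>2 U V = d\<^sup>2 l\<^sup>2\<close> with \<open>l = \<alpha> U + \<beta> V\<close>. Choosing the sign of \<open>i\<close> so that \<open>\<alpha> \<noteq> 0\<close>, the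
  parametrized points are exactly the zeros of this equation, or, for an isotropic line
  (\<open>\<beta> = 0\<close>), of its quotient by the extraneous factor \<open>U\<close>
  (\<open>parameter_iff_conchoid_equation\<close>). Hence the defining point set of the conchoid is already
  Zariski closed and is a plane curve.

  A Zariski closed set parametrized by rational functions of \<open>t\<close> is irreducible, because \<open>K[t]\<close>
  has no zero divisors (\<open>irreducible_rational_image\<close>). Finally the two coordinate functions,
  written over the common denominator \<open>t (\<alpha> + \<beta> t\<^sup>2)\<close>, have no pole that cancels in both of them,
  so as elements of \<open>K(t)\<close> they are simultaneously defined exactly where the parametrization is
  (\<open>fract_values_eq_rational_image\<close>), and they are not both constant since there is a pole at
  \<open>t = 0\<close>.
\<close>

section \<open>Polynomials in two variables\<close>

lemma poly_at_hom [simp]: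
  "poly_at (f + g) P = poly_at f P + poly_at g P"
  "poly_at (f - g) P = poly_at f P - poly_at g P"
  "poly_at (f * g) P = poly_at f P * poly_at g P"
  "poly_at (f ^ n) P = poly_at f P ^ n"
  "poly_at 0 P = 0"
  by (simp_all add: poly_at_def)

lemma poly_at_pCons [simp]: "poly_at (pCons c f) P = poly c (P $ 1) + P $ 2 * poly_at f P"
  by (simp add: poly_at_def)

lemma algebraic_set_zeros: "algebraic_set {P. poly_at f P = 0}"
  unfolding algebraic_set_def by (rule exI[of _ "{f}"]) simp

section \<open>Images of rational parametrizations\<close>

definition rational_image :: "'a::field poly \<Rightarrow> 'a poly \<Rightarrow> 'a poly \<Rightarrow> ('a ^ 2) set" where
  "rational_image N1 N2 D =
     {P. \<exists>t. poly D t \<noteq> 0 \<and> P $ 1 = poly N1 t / poly D t \<and> P $ 2 = poly N2 t / poly D t}"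

lemma vector_in_rational_image:
  "poly D t \<noteq> 0 \<Longrightarrow>
     vector [poly N1 t / poly D t, poly N2 t / poly D t] \<in> rational_image N1 N2 D"
  by (auto simp: rational_image_def)

text \<open>
  Functions that are regular away from the zeros of \<open>D\<close>. They form a ring containing the
  parametrization, hence the pullback of every polynomial in two variables; clearing the
  denominator replaces such a pullback by an element of the integral domain \<open>K[t]\<close>.
\<close>

definition clears_to_poly :: "'a::field poly \<Rightarrow> ('a \<Rightarrow> 'a) \<Rightarrow> bool" where
  "clears_to_poly D g \<longleftrightarrow> (\<exists>H n. \<forall>t. poly D t \<noteq> 0 \<longrightarrow> g t * poly D t ^ n = poly H t)"

lemma clears_to_poly_poly: "clears_to_poly D (poly p)"
  unfolding clears_to_poly_def by (rule exI[of _ p], rule exI[of _ 0]) simp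

lemma clears_to_poly_quotient: "clears_to_poly D (\<lambda>t. poly p t / poly D t)"
  unfolding clears_to_poly_def by (rule exI[of _ p], rule exI[of _ 1]) simp

lemma clears_to_poly_add:
  assumes "clears_to_poly D g" "clears_to_poly D h"
  shows "clears_to_poly D (\<lambda>t. g t + h t)"
proof -
  obtain G m where G: "\<And>t. poly D t \<noteq> 0 \<Longrightarrow> g t * poly D t ^ m = poly G t"
    using assms(1) unfolding clears_to_poly_def by blast
  obtain H n where H: "\<And>t. poly D t \<noteq> 0 \<Longrightarrow> h t * poly D t ^ n = poly H t"
    using assms(2) unfolding clears_to_poly_def by blast
  have "(g t + h t) * poly D t ^ (m + n) = poly (G * D ^ n + H * D ^ m) t"
    if "poly D t \<noteq> 0" for t
    using G[OF that, symmetric] H[OF that, symmetric] by (simp add: power_add algebra_simps)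
  then show ?thesis
    unfolding clears_to_poly_def by blast
qed

lemma clears_to_poly_mult:
  assumes "clears_to_poly D g" "clears_to_poly D h"
  shows "clears_to_poly D (\<lambda>t. g t * h t)"
proof -
  obtain G m where G: "\<And>t. poly D t \<noteq> 0 \<Longrightarrow> g t * poly D t ^ m = poly G t"
    using assms(1) unfolding clears_to_poly_def by blast
  obtain H n where H: "\<And>t. poly D t \<noteq> 0 \<Longrightarrow> h t * poly D t ^ n = poly H t"
    using assms(2) unfolding clears_to_poly_def by blast
  have "(g t * h t) * poly D t ^ (m + n) = poly (G * H) t" if "poly D t \<noteq> 0" for t
    using G[OF that, symmetric] H[OF that, symmetric] by (simp add: power_add algebra_simps)
  then show ?thesis
    unfolding clears_to_poly_def by blast
qed

lemma clears_to_poly_compose: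
  assumes "clears_to_poly D g"
  shows "clears_to_poly D (\<lambda>t. poly p (g t))"
proof (induction p)
  case 0
  show ?case using clears_to_poly_poly[of D 0] by (simp add: clears_to_poly_def)
next
  case (pCons a p)
  have "clears_to_poly D (\<lambda>t. poly [:a:] t + g t * poly p (g t))"
    by (intro clears_to_poly_add clears_to_poly_mult clears_to_poly_poly assms pCons)
  then show ?case by simp
qed

lemma clears_to_poly_poly_at:
  assumes "clears_to_poly D g" "clears_to_poly D h"
  shows "clears_to_poly D (\<lambda>t. poly_at f (vector [g t, h t]))"
proof (induction f)
  case 0
  show ?case using clears_to_poly_poly[of D 0] by (simp add: clears_to_poly_def)
next
  case (pCons c f)
  have "clears_to_poly D (\<lambda>t. poly c (g t) + h t * poly_at f (vector [g t, h t]))"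
    by (intro clears_to_poly_add clears_to_poly_mult clears_to_poly_compose assms pCons)
  then show ?case by simp
qed

text \<open>
  If the image were covered by two proper algebraic subsets, each would satisfy an equation whose
  pullback to \<open>K[t]\<close> is not zero. The product of the two pullbacks with \<open>D\<close> vanishes at every
  \<open>t\<close>, and so is the zero polynomial over an infinite field: a contradiction.
\<close>

lemma irreducible_rational_image:
  fixes D :: "'a::field_char_0 poly"
  assumes "D \<noteq> 0" and alg: "algebraic_set (rational_image N1 N2 D)"
  shows "irreducible_algebraic_set (rational_image N1 N2 D)"
proof -
  let ?Z = "rational_image N1 N2 D"
  let ?pt = "\<lambda>t. vector [poly N1 t / poly D t, poly N2 t / poly D t] :: 'a ^ 2"
  obtain t0 where "poly D t0 \<noteq> 0"
    using \<open>D \<noteq> 0\<close> poly_all_0_iff_0 by blast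
  then have "?Z \<noteq> {}"
    using vector_in_rational_image by blast
  moreover have "?Z = Z1 \<or> ?Z = Z2"
    if Z12: "algebraic_set Z1" "algebraic_set Z2" and Z: "?Z = Z1 \<union> Z2" for Z1 Z2
  proof (rule ccontr)
    assume neither: "\<not> (?Z = Z1 \<or> ?Z = Z2)"
    have separate: "\<exists>H f n. H \<noteq> 0 \<and> (\<forall>P\<in>Y. poly_at f P = 0) \<and>
        (\<forall>t. poly D t \<noteq> 0 \<longrightarrow> poly_at f (?pt t) * poly D t ^ n = poly H t)"
      if Y: "algebraic_set Y" and "\<not> ?Z \<subseteq> Y" for Y
    proof -
      obtain F where F: "Y = {P. \<forall>f\<in>F. poly_at f P = 0}"
        using Y unfolding algebraic_set_def by blast
      obtain P where P: "P \<in> ?Z" "P \<notin> Y"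
        using \<open>\<not> ?Z \<subseteq> Y\<close> by blast
      obtain f where f: "f \<in> F" "poly_at f P \<noteq> 0"
        using P(2) F by blast
      obtain t where t: "poly D t \<noteq> 0" "P = ?pt t"
        using P(1) unfolding rational_image_def by (auto simp: vec_eq_iff forall_2)
      obtain H n where H: "\<And>t. poly D t \<noteq> 0 \<Longrightarrow> poly_at f (?pt t) * poly D t ^ n = poly H t"
        using clears_to_poly_poly_at[OF clears_to_poly_quotient clears_to_poly_quotient, of D f N1 N2]
        unfolding clears_to_poly_def by blast
      have "poly H t \<noteq> 0"
        using H[OF t(1), symmetric] f(2) t by simp
      then have "H \<noteq> 0" by auto
      moreover have "\<forall>P\<in>Y. poly_at f P = 0" using f(1) F by blast
      ultimately show ?thesis using H by blast
    qed
    have proper: "\<not> ?Z \<subseteq> Z1" "\<not> ?Z \<subseteq> Z2"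
      using neither Z by blast+
    obtain H1 f1 n1 where 1: "H1 \<noteq> 0" "\<And>P. P \<in> Z1 \<Longrightarrow> poly_at f1 P = 0"
      "\<And>t. poly D t \<noteq> 0 \<Longrightarrow> poly_at f1 (?pt t) * poly D t ^ n1 = poly H1 t"
      using separate[OF Z12(1) proper(1)] by blast
    obtain H2 f2 n2 where 2: "H2 \<noteq> 0" "\<And>P. P \<in> Z2 \<Longrightarrow> poly_at f2 P = 0"
      "\<And>t. poly D t \<noteq> 0 \<Longrightarrow> poly_at f2 (?pt t) * poly D t ^ n2 = poly H2 t"
      using separate[OF Z12(2) proper(2)] by blast
    have "poly (H1 * H2 * D) t = 0" for t
    proof (cases "poly D t = 0")
      case False
      then have "?pt t \<in> Z1 \<union> Z2"
        using vector_in_rational_image Z by blast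
      then show ?thesis
        using 1(2) 2(2) 1(3)[OF False] 2(3)[OF False] by auto
    qed simp
    then have "H1 * H2 * D = 0"
      using poly_all_0_iff_0 by blast
    then show False
      using 1(1) 2(1) \<open>D \<noteq> 0\<close> by simp
  qed
  ultimately show ?thesis
    using alg unfolding irreducible_algebraic_set_def by blast
qed

lemma fract_value_Fract_iff:
  assumes "poly D t \<noteq> 0"
  shows "fract_value (Fract N D) t v \<longleftrightarrow> v = poly N t / poly D t"
proof
  assume "fract_value (Fract N D) t v"
  then obtain p q where pq: "Fract N D = Fract p q" "poly q t \<noteq> 0" "v = poly p t / poly q t"
    unfolding fract_value_def by blast
  have "D \<noteq> 0" "q \<noteq> 0" using assms pq(2) by auto
  then have "N * q = p * D" using pq(1) eq_fract(1) by blast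
  then have "poly N t * poly q t = poly p t * poly D t"
    by (metis poly_mult)
  then show "v = poly N t / poly D t"
    using assms pq by (simp add: frac_eq_eq)
qed (use assms in \<open>auto simp: fract_value_def\<close>)

lemma fract_value_pole:
  assumes "fract_value (Fract N D) t v" "D \<noteq> 0" "poly D t = 0"
  shows "poly N t = 0"
proof -
  obtain p q where pq: "Fract N D = Fract p q" "poly q t \<noteq> 0"
    using assms unfolding fract_value_def by blast
  have "q \<noteq> 0" using pq(2) by auto
  then have "N * q = p * D" using pq(1) \<open>D \<noteq> 0\<close> eq_fract(1) by blast
  then have "poly N t * poly q t = poly p t * poly D t"
    by (metis poly_mult)
  then show ?thesis using assms pq by simp
qed

text \<open>
  A fraction is defined wherever some representative has a nonzero denominator, so it could have
  values at zeros of \<open>D\<close>. A value there needs the numerator to vanish too, so it is enough that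
  the three polynomials have no common zero; each numerator may share zeros with \<open>D\<close>.
\<close>

lemma fract_values_eq_rational_image:
  assumes "D \<noteq> 0"
    and "\<And>t. poly D t = 0 \<Longrightarrow> poly N1 t \<noteq> 0 \<or> poly N2 t \<noteq> 0"
  shows "{P. \<exists>t. fract_value (Fract N1 D) t (P $ 1) \<and> fract_value (Fract N2 D) t (P $ 2)}
    = rational_image N1 N2 D"
proof -
  have "fract_value (Fract N1 D) t x \<and> fract_value (Fract N2 D) t y \<longleftrightarrow>
      poly D t \<noteq> 0 \<and> x = poly N1 t / poly D t \<and> y = poly N2 t / poly D t" for t x y
    using fract_value_pole[of N1 D t x] fract_value_pole[of N2 D t y] assms
      fract_value_Fract_iff[of D t] by metis
  then show ?thesis unfolding rational_image_def by simp
qed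

lemma rational_curve_rational_image:
  fixes D :: "'a::field_char_0 poly"
  assumes "plane_curve (rational_image N1 N2 D)" and "D \<noteq> 0"
    and reduced: "\<And>t. poly D t = 0 \<Longrightarrow> poly N1 t \<noteq> 0 \<or> poly N2 t \<noteq> 0"
    and pole: "poly D t0 = 0" "poly N1 t0 \<noteq> 0"
  shows "rational_curve (rational_image N1 N2 D)"
proof -
  let ?Z = "rational_image N1 N2 D"
  have alg: "algebraic_set ?Z"
    using assms(1) algebraic_set_zeros unfolding plane_curve_def by metis
  have "\<not> constant_fract (Fract N1 D)"
  proof
    assume "constant_fract (Fract N1 D)"
    then obtain c where "Fract N1 D = Fract [:c:] 1"
      unfolding constant_fract_def by blast
    then have "N1 * 1 = [:c:] * D"
      using \<open>D \<noteq> 0\<close> eq_fract(1) zero_neq_one by metis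
    then show False using pole by simp
  qed
  moreover have "zariski_closure {P. \<exists>t. fract_value (Fract N1 D) t (P $ 1) \<and>
      fract_value (Fract N2 D) t (P $ 2)} = ?Z"
    using fract_values_eq_rational_image[OF \<open>D \<noteq> 0\<close>, of N1 N2] reduced
      hull_same[of algebraic_set, OF alg] by simp
  ultimately show ?thesis
    unfolding rational_curve_def
    using assms(1) irreducible_rational_image[OF \<open>D \<noteq> 0\<close> alg] by blast
qed

section \<open>The conchoid in isotropic coordinates\<close>

text \<open>
  The parameter rationalizes the distance condition \<open>(k - 1)\<^sup>2 W W' = d\<^sup>2\<close>: with
  \<open>t = d / ((k - 1) W)\<close> it reads \<open>W' = t\<^sup>2 W\<close>, after which the equation of the line is linear
  in \<open>W\<close>.
\<close>

lemma conchoid_relation_iff_parameter: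
  fixes U V :: "'a::field"
  assumes "\<gamma> \<noteq> 0" "d \<noteq> 0"
  shows "(\<exists>W W' k. \<alpha> * W + \<beta> * W' = \<gamma> \<and> (U - W) * (V - W') = d\<^sup>2 \<and> U = k * W \<and> V = k * W')
    \<longleftrightarrow> (\<exists>t. t \<noteq> 0 \<and> \<alpha> + \<beta> * t\<^sup>2 \<noteq> 0 \<and> U = \<gamma> / (\<alpha> + \<beta> * t\<^sup>2) + d / t \<and> V = t\<^sup>2 * U)"
    (is "?L \<longleftrightarrow> ?R")
proof
  assume ?L
  then obtain W W' k where h: "\<alpha> * W + \<beta> * W' = \<gamma>" "(U - W) * (V - W') = d\<^sup>2"
    "U = k * W" "V = k * W'" by blast
  have sq: "(k - 1)\<^sup>2 * (W * W') = d\<^sup>2"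
    using h(2) unfolding h(3,4) by (simp add: power2_eq_square algebra_simps)
  then have nz: "k - 1 \<noteq> 0" "W \<noteq> 0" "W' \<noteq> 0" using \<open>d \<noteq> 0\<close> by auto
  define t where "t = d / ((k - 1) * W)"
  have t2: "t\<^sup>2 * W = W'"
    unfolding t_def power_divide sq[symmetric] using nz by (simp add: power2_eq_square)
  have "(\<alpha> + \<beta> * t\<^sup>2) * W = \<gamma>"
    using h(1) by (simp add: t2[symmetric] algebra_simps)
  then have den: "\<alpha> + \<beta> * t\<^sup>2 \<noteq> 0" "\<gamma> / (\<alpha> + \<beta> * t\<^sup>2) = W"
    using \<open>\<gamma> \<noteq> 0\<close> by auto
  have "d / t = (k - 1) * W"
    unfolding t_def using nz \<open>d \<noteq> 0\<close> by simp
  then have "U = \<gamma> / (\<alpha> + \<beta> * t\<^sup>2) + d / t"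
    using h(3) den by (simp add: algebra_simps)
  moreover have "V = t\<^sup>2 * U" using h(3,4) t2 by (simp add: algebra_simps)
  moreover have "t \<noteq> 0" using nz \<open>d \<noteq> 0\<close> by (simp add: t_def)
  ultimately show ?R using den by blast
next
  assume ?R
  then obtain t where t: "t \<noteq> 0" "\<alpha> + \<beta> * t\<^sup>2 \<noteq> 0"
    "U = \<gamma> / (\<alpha> + \<beta> * t\<^sup>2) + d / t" "V = t\<^sup>2 * U" by blast
  define W where "W = \<gamma> / (\<alpha> + \<beta> * t\<^sup>2)"
  have W: "W \<noteq> 0" "\<alpha> * W + \<beta> * (t\<^sup>2 * W) = \<gamma>"
  proof -
    have "(\<alpha> + \<beta> * t\<^sup>2) * W = \<gamma>"
      using t(2) by (simp add: W_def)
    then show "W \<noteq> 0" "\<alpha> * W + \<beta> * (t\<^sup>2 * W) = \<gamma>"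
      using \<open>\<gamma> \<noteq> 0\<close> by (auto simp: algebra_simps)
  qed
  have U: "U - W = d / t" using t(3) by (simp add: W_def)
  have "(U - W) * (V - t\<^sup>2 * W) = t\<^sup>2 * (U - W)\<^sup>2"
    by (simp add: t(4) power2_eq_square algebra_simps)
  also have "\<dots> = d\<^sup>2"
    using t(1) by (simp add: U power_divide)
  finally have "(U - W) * (V - t\<^sup>2 * W) = d\<^sup>2" .
  moreover have "U = U / W * W" "V = U / W * (t\<^sup>2 * W)"
    using W(1) t(4) by simp_all
  ultimately show ?L using W(2) by blast
qed

text \<open>
  For \<open>\<beta> = 0\<close> the quartic of the second case is divisible by \<open>U\<close>, and the line \<open>U = 0\<close> is not
  part of the conchoid; the first case is the quotient.
\<close>

definition conchoid_equation :: "'a::field \<Rightarrow> 'a \<Rightarrow> 'a \<Rightarrow> 'a \<Rightarrow> 'a \<Rightarrow> 'a \<Rightarrow> bool" where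
  "conchoid_equation d \<alpha> \<beta> \<gamma> U V \<longleftrightarrow>
     (if \<beta> = 0 then (\<alpha> * U - \<gamma>)\<^sup>2 * V = d\<^sup>2 * \<alpha>\<^sup>2 * U
      else (\<alpha> * U + \<beta> * V - \<gamma>)\<^sup>2 * (U * V) = d\<^sup>2 * (\<alpha> * U + \<beta> * V)\<^sup>2)"

text \<open>
  A zero with \<open>U \<noteq> 0\<close> determines its parameter: \<open>U (\<alpha> + \<beta> t\<^sup>2) = l\<close> and
  \<open>l - \<gamma> = d (\<alpha> + \<beta> t\<^sup>2) / t\<close> give \<open>t = d l / ((l - \<gamma>) U)\<close>. The only zero with \<open>U = 0\<close> is the
  focus, which is attained at the roots of the numerator \<open>d \<alpha> + \<gamma> t + d \<beta> t\<^sup>2\<close> of \<open>U\<close>. This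
  polynomial is not constant, so it has a root in an algebraically closed field.
\<close>

lemma parameter_iff_conchoid_equation:
  fixes U V :: "'a::alg_closed_field"
  assumes "\<gamma> \<noteq> 0" "d \<noteq> 0" "\<alpha> \<noteq> 0"
  shows "(\<exists>t. t \<noteq> 0 \<and> \<alpha> + \<beta> * t\<^sup>2 \<noteq> 0 \<and> U = \<gamma> / (\<alpha> + \<beta> * t\<^sup>2) + d / t \<and> V = t\<^sup>2 * U)
    \<longleftrightarrow> conchoid_equation d \<alpha> \<beta> \<gamma> U V" (is "?L \<longleftrightarrow> ?R")
proof
  assume ?L
  then obtain t where t: "t \<noteq> 0" "\<alpha> + \<beta> * t\<^sup>2 \<noteq> 0"
    "U = \<gamma> / (\<alpha> + \<beta> * t\<^sup>2) + d / t" "V = t\<^sup>2 * U" by blast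
  define m where "m = \<alpha> + \<beta> * t\<^sup>2"
  have l: "\<alpha> * U + \<beta> * V = m * U"
    by (simp add: t(4) m_def algebra_simps)
  have "t * (m * U - \<gamma>) = d * m"
    using t(1,2) by (simp add: t(3) m_def[symmetric] field_simps)
  then have sq: "t\<^sup>2 * (m * U - \<gamma>)\<^sup>2 = d\<^sup>2 * m\<^sup>2"
    by (metis power_mult_distrib)
  have "(m * U - \<gamma>)\<^sup>2 * (U * V) = (t\<^sup>2 * (m * U - \<gamma>)\<^sup>2) * U\<^sup>2"
    by (simp add: t(4) power2_eq_square)
  also have "\<dots> = d\<^sup>2 * (m * U)\<^sup>2"
    by (simp add: sq power_mult_distrib)
  finally have gen: "(m * U - \<gamma>)\<^sup>2 * (U * V) = d\<^sup>2 * (m * U)\<^sup>2" .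
  have "(m * U - \<gamma>)\<^sup>2 * V = (t\<^sup>2 * (m * U - \<gamma>)\<^sup>2) * U"
    by (simp add: t(4))
  then have "(m * U - \<gamma>)\<^sup>2 * V = d\<^sup>2 * m\<^sup>2 * U"
    by (simp add: sq)
  then show ?R
    using gen l by (auto simp: conchoid_equation_def m_def)
next
  assume R: ?R
  show ?L
  proof (cases "U = 0")
    case True
    have "V = 0"
      using R True assms by (auto simp: conchoid_equation_def split: if_splits)
    obtain t where "poly [:d * \<alpha>, \<gamma>, d * \<beta>:] t = 0"
      using alg_closed_imp_poly_has_root[of "[:d * \<alpha>, \<gamma>, d * \<beta>:]"] \<open>\<gamma> \<noteq> 0\<close> by auto
    then have root: "d * (\<alpha> + \<beta> * t\<^sup>2) + \<gamma> * t = 0"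
      by (simp add: power2_eq_square algebra_simps)
    have t: "t \<noteq> 0" using root assms by auto
    moreover have m: "\<alpha> + \<beta> * t\<^sup>2 \<noteq> 0" using root t assms by auto
    moreover have "\<gamma> / (\<alpha> + \<beta> * t\<^sup>2) + d / t = 0"
      using t m root by (simp add: add_frac_eq algebra_simps)
    ultimately show ?L using True \<open>V = 0\<close> by auto
  next
    case U: False
    define l where "l = \<alpha> * U + \<beta> * V"
    have eq: "(l - \<gamma>)\<^sup>2 * (U * V) = d\<^sup>2 * l\<^sup>2"
    proof (cases "\<beta> = 0")
      case True
      then have "(\<alpha> * U - \<gamma>)\<^sup>2 * V * U = d\<^sup>2 * \<alpha>\<^sup>2 * U * U"
        using R by (simp add: conchoid_equation_def)
      then show ?thesis using True by (simp add: l_def power2_eq_square algebra_simps)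
    qed (use R in \<open>simp add: conchoid_equation_def l_def\<close>)
    have V: "V \<noteq> 0" using eq U assms by (auto simp: l_def)
    have l\<gamma>: "l - \<gamma> \<noteq> 0" using eq assms by auto
    have "l \<noteq> 0"
      using eq U V l\<gamma> by auto
    define t where "t = d * l / ((l - \<gamma>) * U)"
    have t: "t \<noteq> 0" using \<open>l \<noteq> 0\<close> l\<gamma> U assms by (simp add: t_def)
    have "t\<^sup>2 = (d\<^sup>2 * l\<^sup>2) / ((l - \<gamma>)\<^sup>2 * U\<^sup>2)"
      by (simp add: t_def power_divide power_mult_distrib)
    also have "\<dots> = V / U"
      unfolding eq[symmetric] using l\<gamma> U by (simp add: power2_eq_square)
    finally have VU: "V = t\<^sup>2 * U" using U by simp
    have mU: "l = (\<alpha> + \<beta> * t\<^sup>2) * U"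
      by (simp add: l_def VU algebra_simps)
    then have m: "\<alpha> + \<beta> * t\<^sup>2 \<noteq> 0" using \<open>l \<noteq> 0\<close> by auto
    have "d / t = (l - \<gamma>) * U / l"
      using assms by (simp add: t_def)
    also have "\<dots> = (l - \<gamma>) * U / ((\<alpha> + \<beta> * t\<^sup>2) * U)"
      by (simp only: mU)
    also have "\<dots> = (l - \<gamma>) / (\<alpha> + \<beta> * t\<^sup>2)"
      using U by simp
    finally have "\<gamma> / (\<alpha> + \<beta> * t\<^sup>2) + d / t = l / (\<alpha> + \<beta> * t\<^sup>2)"
      by (simp add: add_divide_distrib[symmetric])
    then have "U = \<gamma> / (\<alpha> + \<beta> * t\<^sup>2) + d / t"
      using m by (simp add: mU)
    then show ?L using t m VU by blast
  qed
qed

text \<open>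
  The coordinates \<open>u\<close>, \<open>v\<close> below are centred at the focus \<open>A\<close>, and the line is
  \<open>\<alpha> u + \<beta> v = \<gamma>\<close>; then \<open>\<gamma> \<noteq> 0\<close> says that the focus is not on it.
\<close>

locale isotropic_frame =
  fixes i :: "'a::{alg_closed_field, field_char_0}" and A :: "'a ^ 2" and d \<alpha> \<beta> \<gamma> :: 'a
  assumes i_square: "i\<^sup>2 = -1" and d: "d \<noteq> 0" and \<alpha>: "\<alpha> \<noteq> 0" and \<gamma>: "\<gamma> \<noteq> 0"
begin

definition u :: "'a ^ 2 \<Rightarrow> 'a" where "u P = (P $ 1 - A $ 1) + i * (P $ 2 - A $ 2)"
definition v :: "'a ^ 2 \<Rightarrow> 'a" where "v P = (P $ 1 - A $ 1) - i * (P $ 2 - A $ 2)"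

lemma sqnorm_isotropic: "sqnorm (P - Q) = (u P - u Q) * (v P - v Q)"
proof -
  have "(u P - u Q) * (v P - v Q) = (P $ 1 - Q $ 1)\<^sup>2 - i\<^sup>2 * (P $ 2 - Q $ 2)\<^sup>2"
    unfolding u_def v_def by (simp add: power2_eq_square algebra_simps)
  then show ?thesis by (simp add: sqnorm_def i_square)
qed

lemma coordinates_from_uv:
  "P $ 1 = A $ 1 + (u P + v P) / 2"
  "P $ 2 = A $ 2 - i * (u P - v P) / 2"
proof -
  have "u P + v P = (P $ 1 - A $ 1) * 2"
    unfolding u_def v_def by simp
  then have "(u P + v P) / 2 = P $ 1 - A $ 1"
    by (simp only: nonzero_mult_div_cancel_right[OF zero_neq_numeral[symmetric]])
  then have "A $ 1 + (u P + v P) / 2 = A $ 1 + (P $ 1 - A $ 1)"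
    by (simp only:)
  then show "P $ 1 = A $ 1 + (u P + v P) / 2"
    by (simp only:) simp
  have "i * (u P - v P) = i\<^sup>2 * (P $ 2 - A $ 2) * 2"
    unfolding u_def v_def by (simp add: power2_eq_square algebra_simps)
  then have "i * (u P - v P) / 2 = i\<^sup>2 * (P $ 2 - A $ 2)"
    by (simp only: nonzero_mult_div_cancel_right[OF zero_neq_numeral[symmetric]])
  then have "A $ 2 - i * (u P - v P) / 2 = A $ 2 + (P $ 2 - A $ 2)"
    by (simp only: i_square mult_minus1 diff_minus_eq_add)
  then show "P $ 2 = A $ 2 - i * (u P - v P) / 2"
    by (simp only:) simp
qed

lemma point_eq_iff: "P = Q \<longleftrightarrow> u P = u Q \<and> v P = v Q"
proof
  assume "u P = u Q \<and> v P = v Q"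
  then have "P $ 1 = Q $ 1" "P $ 2 = Q $ 2"
    using coordinates_from_uv[of P] coordinates_from_uv[of Q] by simp_all
  then show "P = Q" by (simp add: vec_eq_iff forall_2)
qed simp

definition point :: "'a \<Rightarrow> 'a \<Rightarrow> 'a ^ 2" where
  "point U V = vector [A $ 1 + (U + V) / 2, A $ 2 - i * (U - V) / 2]"

lemma uv_point [simp]: "u (point U V) = U" "v (point U V) = V"
proof -
  have *: "i * (i * x) = - x" for x
    using i_square by (simp add: power2_eq_square mult.assoc[symmetric])
  have "i * (A $ 2 - i * (U - V) / 2 - A $ 2) = - (i * (i * ((U - V) / 2)))"
    by simp
  then have 2: "i * (point U V $ 2 - A $ 2) = (U - V) / 2"
    by (simp only: * minus_minus point_def vector_2)
  have 1: "point U V $ 1 - A $ 1 = (U + V) / 2"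
    by (simp add: point_def)
  show "u (point U V) = U" "v (point U V) = V"
    unfolding u_def v_def 1 2
    by (simp_all add: add_divide_distrib[symmetric] diff_divide_distrib[symmetric] mult_2[symmetric])
qed

definition curve_poly :: "'a poly poly" where
  "curve_poly =
    (let X = [:[:- A $ 1 - i * A $ 2, 1:], [:i:]:]; Y = [:[:- A $ 1 + i * A $ 2, 1:], [:- i:]:];
         l = [:[:\<alpha>:]:] * X + [:[:\<beta>:]:] * Y
     in if \<beta> = 0 then ([:[:\<alpha>:]:] * X - [:[:\<gamma>:]:])\<^sup>2 * Y - [:[:d\<^sup>2 * \<alpha>\<^sup>2:]:] * X
        else (l - [:[:\<gamma>:]:])\<^sup>2 * (X * Y) - [:[:d\<^sup>2:]:] * l\<^sup>2)"

lemma poly_at_curve_poly: "poly_at curve_poly P = 0 \<longleftrightarrow> conchoid_equation d \<alpha> \<beta> \<gamma> (u P) (v P)"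
proof -
  have X: "poly_at [:[:- A $ 1 - i * A $ 2, 1:], [:i:]:] P = u P"
    by (simp add: u_def algebra_simps)
  have Y: "poly_at [:[:- A $ 1 + i * A $ 2, 1:], [:- i:]:] P = v P"
    by (simp add: v_def algebra_simps)
  have c: "poly_at [:[:c:]:] P = c" for c
    by simp
  show ?thesis
    unfolding curve_poly_def Let_def conchoid_equation_def
    by (auto simp only: if_split poly_at_hom X Y c right_minus_eq split: if_split)
qed

text \<open>
  The equation is not a constant polynomial: it vanishes at the focus but not at the point where
  the line meets \<open>v = 0\<close>.
\<close>

lemma plane_curve_conchoid_equation:
  "plane_curve {P. conchoid_equation d \<alpha> \<beta> \<gamma> (u P) (v P)}"
proof -
  have "curve_poly \<noteq> [:[:c:]:]" for c
  proof
    assume c: "curve_poly = [:[:c:]:]"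
    have "poly_at curve_poly (point 0 0) = 0"
      by (simp add: poly_at_curve_poly conchoid_equation_def)
    moreover have "poly_at curve_poly (point (\<gamma> / \<alpha>) 0) \<noteq> 0"
      unfolding poly_at_curve_poly using \<alpha> \<gamma> d by (simp add: conchoid_equation_def)
    ultimately show False
      unfolding c by simp
  qed
  then show ?thesis
    unfolding plane_curve_def poly_at_curve_poly[symmetric] by blast
qed

text \<open>
  The parametrization in the original coordinates, over the common denominator
  \<open>t (\<alpha> + \<beta> t\<^sup>2)\<close>; \<open>param_num_u\<close> is the numerator of \<open>u\<close>, and \<open>v = t\<^sup>2 u\<close>.
\<close>

definition param_den :: "'a poly" where "param_den = [:0, \<alpha>, 0, \<beta>:]"
definition param_num_u :: "'a poly" where "param_num_u = [:d * \<alpha>, \<gamma>, d * \<beta>:]"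
definition param_num_1 :: "'a poly" where
  "param_num_1 = smult (A $ 1) param_den + smult (1 / 2) ([:1, 0, 1:] * param_num_u)"
definition param_num_2 :: "'a poly" where
  "param_num_2 = smult (A $ 2) param_den - smult (i / 2) ([:1, 0, -1:] * param_num_u)"

lemma poly_param_den: "poly param_den t = t * (\<alpha> + \<beta> * t\<^sup>2)"
  by (simp add: param_den_def power2_eq_square algebra_simps)

lemma poly_param_num_u: "poly param_num_u t = d * (\<alpha> + \<beta> * t\<^sup>2) + \<gamma> * t"
  by (simp add: param_num_u_def power2_eq_square algebra_simps)

text \<open>
  The value is \<open>d \<alpha>\<close> at \<open>t = 0\<close> and \<open>\<gamma> t\<close> at the zeros of \<open>\<alpha> + \<beta> t\<^sup>2\<close>, which are nonzero as
  \<open>\<alpha> \<noteq> 0\<close>.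
\<close>

lemma param_num_u_nonzero_at_poles:
  assumes "poly param_den t = 0"
  shows "poly param_num_u t \<noteq> 0"
  using assms \<alpha> \<gamma> d by (auto simp: poly_param_den poly_param_num_u)

lemma poly_param_nums:
  "poly param_num_1 t = A $ 1 * poly param_den t + (1 + t\<^sup>2) * poly param_num_u t / 2"
  "poly param_num_2 t = A $ 2 * poly param_den t - i * ((1 - t\<^sup>2) * poly param_num_u t) / 2"
  by (simp_all add: param_num_1_def param_num_2_def power2_eq_square) (simp_all add: algebra_simps)

lemma rational_image_eq_conchoid_equation:
  "rational_image param_num_1 param_num_2 param_den
     = {P. conchoid_equation d \<alpha> \<beta> \<gamma> (u P) (v P)}"
proof -
  have "(P $ 1 = poly param_num_1 t / poly param_den t \<and> P $ 2 = poly param_num_2 t / poly param_den t)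
      \<longleftrightarrow> u P = \<gamma> / (\<alpha> + \<beta> * t\<^sup>2) + d / t \<and> v P = t\<^sup>2 * u P"
    if t: "poly param_den t \<noteq> 0" for P t
  proof -
    define w where "w = poly param_num_u t / poly param_den t"
    have w: "w = \<gamma> / (\<alpha> + \<beta> * t\<^sup>2) + d / t"
      using t unfolding w_def poly_param_den poly_param_num_u by (simp add: add_frac_eq mult.commute)
    have num: "poly param_num_u t = w * poly param_den t"
      using t by (simp add: w_def)
    have "poly param_num_1 t = point w (t\<^sup>2 * w) $ 1 * poly param_den t"
      "poly param_num_2 t = point w (t\<^sup>2 * w) $ 2 * poly param_den t"
      unfolding poly_param_nums num point_def vector_2 by (simp_all add: algebra_simps)
    then have "poly param_num_1 t / poly param_den t = point w (t\<^sup>2 * w) $ 1"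
      "poly param_num_2 t / poly param_den t = point w (t\<^sup>2 * w) $ 2"
      using t by simp_all
    then have "(P $ 1 = poly param_num_1 t / poly param_den t \<and>
        P $ 2 = poly param_num_2 t / poly param_den t) \<longleftrightarrow> P = point w (t\<^sup>2 * w)"
      by (simp add: vec_eq_iff forall_2)
    also have "\<dots> \<longleftrightarrow> u P = w \<and> v P = t\<^sup>2 * u P"
      by (auto simp: point_eq_iff)
    finally show ?thesis unfolding w .
  qed
  moreover have "poly param_den t \<noteq> 0 \<longleftrightarrow> t \<noteq> 0 \<and> \<alpha> + \<beta> * t\<^sup>2 \<noteq> 0" for t
    by (simp add: poly_param_den)
  ultimately show ?thesis
    unfolding rational_image_def parameter_iff_conchoid_equation[OF \<gamma> d \<alpha>, symmetric]
    by (intro Collect_cong) (metis (no_types, lifting))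
qed

lemma conchoid_points_eq:
  "{x. \<exists>y\<in>{y. \<alpha> * u y + \<beta> * v y = \<gamma>}. \<exists>k. sqnorm (x - y) = d\<^sup>2 \<and> x = A + k *s (y - A)}
     = {P. conchoid_equation d \<alpha> \<beta> \<gamma> (u P) (v P)}"
proof (intro Collect_cong)
  fix x
  have scaled: "x = A + k *s (y - A) \<longleftrightarrow> u x = k * u y \<and> v x = k * v y" for k y
  proof -
    have "u (A + k *s (y - A)) = k * u y" "v (A + k *s (y - A)) = k * v y"
      by (simp_all add: u_def v_def algebra_simps)
    then show ?thesis by (simp add: point_eq_iff)
  qed
  have "(\<exists>y\<in>{y. \<alpha> * u y + \<beta> * v y = \<gamma>}. \<exists>k. sqnorm (x - y) = d\<^sup>2 \<and> x = A + k *s (y - A))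
      \<longleftrightarrow> (\<exists>W W' k. \<alpha> * W + \<beta> * W' = \<gamma> \<and> (u x - W) * (v x - W') = d\<^sup>2 \<and> u x = k * W \<and> v x = k * W')"
    (is "?L \<longleftrightarrow> ?R")
  proof
    assume ?L
    then show ?R unfolding scaled sqnorm_isotropic by blast
  next
    assume ?R
    then obtain W W' k where "\<alpha> * W + \<beta> * W' = \<gamma>" "(u x - W) * (v x - W') = d\<^sup>2"
      "u x = k * W" "v x = k * W'" by blast
    then show ?L
      unfolding scaled sqnorm_isotropic
      by (intro bexI[of _ "point W W'"] exI[of _ k]) simp_all
  qed
  then show "(\<exists>y\<in>{y. \<alpha> * u y + \<beta> * v y = \<gamma>}. \<exists>k. sqnorm (x - y) = d\<^sup>2 \<and> x = A + k *s (y - A))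
      \<longleftrightarrow> conchoid_equation d \<alpha> \<beta> \<gamma> (u x) (v x)"
    unfolding conchoid_relation_iff_parameter[OF \<gamma> d] parameter_iff_conchoid_equation[OF \<gamma> d \<alpha>] .
qed

lemma conchoid_eq_rational_image:
  "conchoid {y. \<alpha> * u y + \<beta> * v y = \<gamma>} A d = rational_image param_num_1 param_num_2 param_den"
proof -
  have "algebraic_set {P. conchoid_equation d \<alpha> \<beta> \<gamma> (u P) (v P)}"
    unfolding poly_at_curve_poly[symmetric] by (rule algebraic_set_zeros)
  then show ?thesis
    unfolding conchoid_def conchoid_points_eq rational_image_eq_conchoid_equation
    by (rule hull_same)
qed

lemma rational_curve_conchoid: "rational_curve (conchoid {y. \<alpha> * u y + \<beta> * v y = \<gamma>} A d)"
  unfolding conchoid_eq_rational_image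
proof (rule rational_curve_rational_image)
  show "plane_curve (rational_image param_num_1 param_num_2 param_den)"
    unfolding rational_image_eq_conchoid_equation by (rule plane_curve_conchoid_equation)
  show "param_den \<noteq> 0" using \<alpha> by (simp add: param_den_def)
  show "poly param_den 0 = 0" by (simp add: poly_param_den)
  show "poly param_num_1 0 \<noteq> 0"
    using \<alpha> d by (simp add: poly_param_nums poly_param_den poly_param_num_u)
  show "poly param_num_1 t \<noteq> 0 \<or> poly param_num_2 t \<noteq> 0" if t: "poly param_den t = 0" for t
  proof (rule ccontr)
    \<comment> \<open>At a zero of the denominator the numerators are multiples of \<open>1 + t\<^sup>2\<close> and \<open>1 - t\<^sup>2\<close> times
      the nonzero value of \<open>param_num_u\<close>, and these two factors have the sum \<open>2\<close>.\<close>
    assume "\<not> ?thesis"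
    then have "(1 + t\<^sup>2) * poly param_num_u t = 0" "i * ((1 - t\<^sup>2) * poly param_num_u t) = 0"
      using t by (simp_all add: poly_param_nums)
    moreover have "i \<noteq> 0" using i_square by auto
    ultimately have "1 + t\<^sup>2 = 0" "1 - t\<^sup>2 = 0"
      using param_num_u_nonzero_at_poles[OF t] by simp_all
    then have "(1 + t\<^sup>2) + (1 - t\<^sup>2) = 0" by (simp only: add_0_left)
    then show False by simp
  qed
qed

end

section \<open>Conchoids of Nicomedes\<close>

theorem corollary3p18:
  fixes C :: "('a::{alg_closed_field, field_char_0} ^ 2) set"
    and A :: "'a ^ 2" and d :: 'a
  assumes "affine_line C"
    and "\<And>i. i\<^sup>2 = -1 \<Longrightarrow> C \<noteq> {y. y $ 1 + i * y $ 2 = 0}"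
    and "A \<notin> C"
    and "d \<noteq> 0"
  shows "rational_curve (conchoid C A d)"
proof -
  obtain a b c where ab: "a \<noteq> 0 \<or> b \<noteq> 0" and C: "C = {y. a * y $ 1 + b * y $ 2 + c = 0}"
    using assms(1) unfolding affine_line_def by blast
  obtain j :: 'a where j: "j\<^sup>2 = -1"
    using nth_root_exists[of 2 "-1 :: 'a"] by auto
  then have "j \<noteq> 0" by auto
  \<comment> \<open>Replacing \<open>i\<close> by \<open>- i\<close> exchanges \<open>u\<close> and \<open>v\<close>, so one of the signs makes the
    coefficient of \<open>u\<close> nonzero.\<close>
  have "\<exists>i. i\<^sup>2 = -1 \<and> a - i * b \<noteq> 0"
  proof (rule ccontr)
    assume "\<not> ?thesis"
    then have h: "\<And>i. i\<^sup>2 = -1 \<Longrightarrow> a = i * b" by simp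
    have "a = j * b" "a = - j * b"
      using h[of j] h[of "- j"] j by simp_all
    then have "a = j * b" "2 * (j * b) = 0"
      by (simp_all only: mult_2) (metis add.right_inverse mult_minus_left)
    then show False using \<open>j \<noteq> 0\<close> ab by simp
  qed
  then obtain i where i: "i\<^sup>2 = -1" "a - i * b \<noteq> 0" by blast
  \<comment> \<open>Substituting \<open>u\<close> and \<open>v\<close> into the equation of the line leaves denominators 2, so all
    coefficients are taken twice.\<close>
  define \<gamma> where "\<gamma> = - 2 * (a * A $ 1 + b * A $ 2 + c)"
  have "\<gamma> \<noteq> 0" using assms(3) by (simp only: C mem_Collect_eq \<gamma>_def mult_eq_0_iff) simp
  interpret isotropic_frame i A d "a - i * b" "a + i * b" \<gamma>
    using i assms(4) \<open>\<gamma> \<noteq> 0\<close> by unfold_locales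
  have "(a - i * b) * u y + (a + i * b) * v y
      = 2 * (a * (y $ 1 - A $ 1)) - 2 * i\<^sup>2 * (b * (y $ 2 - A $ 2))" for y
    unfolding u_def v_def by (simp add: power2_eq_square algebra_simps)
  then have "(a - i * b) * u y + (a + i * b) * v y - \<gamma> = 2 * (a * y $ 1 + b * y $ 2 + c)" for y
    by (simp add: i(1) \<gamma>_def algebra_simps)
  then have "C = {y. (a - i * b) * u y + (a + i * b) * v y = \<gamma>}"
    unfolding C by (metis (no_types, lifting) mult_eq_0_iff right_minus_eq zero_neq_numeral)
  then show ?thesis using rational_curve_conchoid by simp
qed

end
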